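(* Let $\beta>1$ be a quadratic Pisot unit whose algebraic conjugate is positive. Then every rational number $x\in I_\beta=\left[-\frac{\beta}{\beta+1},\frac{1}{\beta+1}\right)$ has a purely periodic $(-\beta)$-expansion, i.e. the digit string $d_{-\beta}(x)$ is purely periodic.
   Context: For $\beta>1$ let $I_\beta=\left[-\frac{\beta}{\beta+1},\frac{1}{\beta+1}\right)$ and define $T_{-\beta}:I_\beta\to I_\beta$ by $T_{-\beta}(x)=-\beta x-\left\lfloor -\beta x+\frac{\beta}{\beta+1}\right\rfloor$. For $x\in I_\beta$ put $x_i=\left\lfloor -\beta T_{-\beta}^{i-1}(x)+\frac{\beta}{\beta+1}\right\rfloor\in\{0,1,\dots,\lfloor\beta\rfloor\}$; then $x=\sum_{i\ge1}x_i(-\beta)^{-i}$, and $d_{-\beta}(x):=x_1x_2x_3\cdots$ is the $(-\beta)$-expansion of $x$. It is purely periodic if $d_{-\beta}(x)=(a_1\cdots a_N)^\omega$ for some finite word $a_1\cdots a_N$. *)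

theory Defs
  imports
    "HOL-Computational_Algebra.Computational_Algebra"
    "HOL-Library.Stream"
    Complex_Main
begin

definition is_min_poly :: "rat poly \<Rightarrow> real \<Rightarrow> bool" where
  "is_min_poly p \<beta> \<longleftrightarrow>
     lead_coeff p = 1 \<and> irreducible p \<and> poly (map_poly of_rat p) \<beta> = 0"

definition conjugates :: "real \<Rightarrow> complex set" where
  "conjugates \<beta> = {z. \<exists>p. is_min_poly p \<beta> \<and> poly (map_poly of_rat p) z = 0}"

definition quadratic :: "real \<Rightarrow> bool" where
  "quadratic \<beta> \<longleftrightarrow> (\<exists>p. is_min_poly p \<beta> \<and> degree p = 2)"

definition pisot :: "real \<Rightarrow> bool" where
  "pisot \<beta> \<longleftrightarrow>
     algebraic_int \<beta> \<and> \<beta> > 1 \<and> (\<forall>z \<in> conjugates \<beta> - {complex_of_real \<beta>}. cmod z < 1)"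

definition algebraic_unit :: "real \<Rightarrow> bool" where
  "algebraic_unit \<beta> \<longleftrightarrow> \<beta> \<noteq> 0 \<and> algebraic_int \<beta> \<and> algebraic_int (inverse \<beta>)"

definition I_neg :: "real \<Rightarrow> real set" where
  "I_neg \<beta> = {- (\<beta> / (\<beta> + 1)) ..< 1 / (\<beta> + 1)}"

definition T_neg :: "real \<Rightarrow> real \<Rightarrow> real" where
  "T_neg \<beta> x = - \<beta> * x - of_int \<lfloor>- \<beta> * x + \<beta> / (\<beta> + 1)\<rfloor>"

text \<open>Digit positions \<open>i\<close> start at \<open>1\<close>.\<close>

definition digit_neg :: "real \<Rightarrow> real \<Rightarrow> nat \<Rightarrow> int" where
  "digit_neg \<beta> x i = \<lfloor>- \<beta> * (T_neg \<beta> ^^ (i - 1)) x + \<beta> / (\<beta> + 1)\<rfloor>"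

definition d_neg :: "real \<Rightarrow> real \<Rightarrow> int stream" where
  "d_neg \<beta> x = smap (digit_neg \<beta> x) (fromN 1)"

definition purely_periodic :: "'a stream \<Rightarrow> bool" where
  "purely_periodic s \<longleftrightarrow> (\<exists>w. w \<noteq> [] \<and> s = cycle w)"

lemma T_neg_in_I_neg:
  assumes "\<beta> > 1"
  shows "T_neg \<beta> x \<in> I_neg \<beta>"
proof -
  define y where "y = - \<beta> * x + \<beta> / (\<beta> + 1)"
  have "T_neg \<beta> x = frac y - \<beta> / (\<beta> + 1)"
    by (simp add: T_neg_def frac_def y_def)
  moreover have "1 / (\<beta> + 1) = 1 - \<beta> / (\<beta> + 1)"
    using assms by (simp add: field_simps)
  ultimately show ?thesis
    using frac_ge_0[of y] frac_lt_1[of y] by (simp add: I_neg_def)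
qed

end

theory Submission
  imports Defs
begin

text \<open>
  By Gauss's lemma the conjugate of \<open>\<beta>\<close> is \<open>1 / \<beta>\<close> and \<open>\<beta> + 1 / \<beta>\<close> is an integer. Running the
  conjugate of the orbit along with the orbit gives the natural extension
  \<open>(u, v) \<mapsto> (T u, - v / \<beta> - d(u))\<close>, where \<open>d(u)\<close> is the first digit of \<open>u\<close>. It maps a bounded domain
  injectively into itself, and it preserves the lattice of pairs of conjugate elements of
  \<open>(1 / N) \<int>[\<beta>]\<close>, which meets the domain in a finite set. Hence every lattice point of the domain
  is periodic. A rational \<open>x\<close> is its own conjugate, and \<open>(x, x)\<close> lies in the domain.
\<close>

section \<open>Gauss's lemma and the minimal polynomial of a quadratic unit\<close>

lemma rat_poly_common_denominator:
  fixes p :: "rat poly"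
  obtains a :: int and P :: "int poly"
  where "a \<noteq> 0" "map_poly of_int P = smult (of_int a) p"
proof -
  have "\<exists>a P. a \<noteq> 0 \<and> map_poly of_int P = smult (of_int a) p"
  proof (induction p)
    case 0
    have "map_poly of_int 0 = smult (of_int 1) (0 :: rat poly)" by simp
    then show ?case using one_neq_zero by blast
  next
    case (pCons c p)
    then obtain a P where aP: "a \<noteq> 0" "map_poly of_int P = smult (of_int a) p" by blast
    obtain r s where c: "quotient_of c = (r, s)" by (cases "quotient_of c")
    have s: "s \<noteq> 0" "c = of_int r / of_int s"
      using quotient_of_denom_pos[OF c] quotient_of_div[OF c] by auto
    have "map_poly of_int (pCons (a * r) (smult s P)) = smult (of_int (s * a)) (pCons c p)"
      using aP s by (simp add: map_poly_pCons map_poly_smult)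
    moreover have "s * a \<noteq> 0" using aP s by simp
    ultimately show ?case by blast
  qed
  then show ?thesis using that by blast
qed

lemma map_poly_of_int_mult:
  "map_poly of_int (p * q) = (map_poly of_int p * map_poly of_int q :: 'a :: comm_ring_1 poly)"
  by (rule poly_eqI) (simp add: coeff_map_poly coeff_mult)

lemma map_poly_of_rat_mult:
  "map_poly of_rat (p * q) = (map_poly of_rat p * map_poly of_rat q :: 'a :: field_char_0 poly)"
  by (rule poly_eqI) (simp add: coeff_map_poly coeff_mult of_rat_sum of_rat_mult)

lemma map_poly_of_rat_add:
  "map_poly of_rat (p + q) = (map_poly of_rat p + map_poly of_rat q :: 'a :: field_char_0 poly)"
  by (rule poly_eqI) (simp add: coeff_map_poly of_rat_add)

lemma map_poly_of_int_rat_inject: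
  "map_poly of_int p = (map_poly of_int q :: rat poly) \<Longrightarrow> p = q"
  by (metis coeff_map_poly of_int_0 of_int_eq_iff poly_eqI)

text \<open>Clear the denominators of the rational quotient by \<open>b\<close>. Since the content
  is multiplicative and \<open>P\<close> is primitive, \<open>b\<close> divides the content of the
  cleared quotient \<open>G\<close> and can be cancelled again.\<close>

lemma primitive_dvd_int_poly:
  fixes P f :: "int poly"
  assumes "content P = 1" and "(map_poly of_int P :: rat poly) dvd map_poly of_int f"
  shows "P dvd f"
proof -
  obtain g where g: "map_poly of_int f = map_poly of_int P * (g :: rat poly)"
    using assms(2) by blast
  obtain b G where b: "b \<noteq> 0" and G: "map_poly of_int G = smult (of_int b) g"
    by (rule rat_poly_common_denominator)
  have "map_poly of_int (smult b f) = (map_poly of_int (P * G) :: rat poly)"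
    by (simp add: map_poly_smult map_poly_of_int_mult g G)
  then have eq: "smult b f = P * G" by (rule map_poly_of_int_rat_inject)
  then have "content (smult b f) = content (P * G)" by simp
  then have "content G = \<bar>b\<bar> * content f"
    using assms(1) by (simp add: content_mult)
  then have "b dvd content G" by simp
  then have "[:b:] dvd G" by (simp add: const_poly_dvd_iff_dvd_content)
  then obtain G' where "G = [:b:] * G'" by (elim dvdE)
  then have "smult b f = smult b (P * G')" using eq by simp
  then have "f = P * G'" using b by (metis smult_cancel)
  then show ?thesis by simp
qed

text \<open>Division with remainder shows that a nonzero polynomial \<open>g\<close> of least degree
  vanishing at \<open>z\<close> divides all polynomials vanishing there, among them
  \<open>p\<close>. As a nonzero constant has no root, \<open>g\<close> is not a unit, so
  \<open>p\<close> divides \<open>g\<close> by irreducibility.\<close>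

lemma irreducible_dvd_common_root:
  fixes p f :: "rat poly" and z :: "'a :: field_char_0"
  assumes "irreducible p" "poly (map_poly of_rat p) z = 0" "poly (map_poly of_rat f) z = 0"
  shows "p dvd f"
proof -
  define V where "V = (\<lambda>h :: rat poly. poly (map_poly of_rat h) z = 0)"
  have "p \<noteq> 0 \<and> V p" using assms by (auto simp: V_def)
  then obtain g where g: "g \<noteq> 0" "V g" and min: "\<And>h. h \<noteq> 0 \<Longrightarrow> V h \<Longrightarrow> degree g \<le> degree h"
    using ex_has_least_nat[of "\<lambda>h. h \<noteq> 0 \<and> V h" p degree] by blast
  have g_dvd: "g dvd h" if "V h" for h
  proof -
    have "poly (map_poly of_rat h) z = poly (map_poly of_rat (g * (h div g) + h mod g)) z" by simp
    also have "\<dots> = poly (map_poly of_rat (h mod g)) z"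
      using g(2) by (simp only: map_poly_of_rat_add map_poly_of_rat_mult poly_add poly_mult V_def) simp
    finally have "V (h mod g)" using that by (simp add: V_def)
    then have "h mod g = 0"
      using min[of "h mod g"] degree_mod_less'[OF g(1), of h] by linarith
    then show ?thesis by (simp add: dvd_eq_mod_eq_0)
  qed
  have "\<not> is_unit g"
  proof
    assume "is_unit g"
    then obtain c where "g = [:c:]" by (auto simp: is_unit_poly_iff)
    then show False using g by (simp add: V_def map_poly_pCons)
  qed
  then have "p dvd g"
    using irreducibleD'[OF assms(1)] g_dvd[of p] assms(2) by (auto simp: V_def)
  then show ?thesis
    using g_dvd[of f] assms(3) dvd_trans by (auto simp: V_def)
qed

lemma map_poly_of_rat_of_int:
  "map_poly of_rat (map_poly of_int p) = (map_poly of_int p :: 'a :: field_char_0 poly)"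
  by (rule poly_eqI) (simp add: coeff_map_poly)

lemma map_poly_of_rat_smult:
  "map_poly of_rat (smult c p) = (smult (of_rat c) (map_poly of_rat p) :: 'a :: field_char_0 poly)"
  by (rule poly_eqI) (simp add: coeff_map_poly of_rat_mult)

lemma reflect_poly_map_poly_of_int:
  "reflect_poly (map_poly of_int p) = (map_poly of_int (reflect_poly p) :: 'a :: {ring_char_0, comm_ring_1} poly)"
proof (rule poly_eqI)
  have "degree (map_poly of_int p :: 'a poly) = degree p"
    by (rule degree_map_poly) simp
  then show "coeff (reflect_poly (map_poly of_int p)) n = (coeff (map_poly of_int (reflect_poly p)) n :: 'a)" for n
    by (simp add: coeff_reflect_poly coeff_map_poly)
qed

text \<open>The primitive integer multiple \<open>P\<close> of the minimal polynomial divides every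
  integer polynomial that vanishes at \<open>\<beta>\<close>. Hence integrality of
  \<open>\<beta>\<close> forces its leading coefficient to be 1 or -1, and integrality of
  \<open>1 / \<beta>\<close> does so for its constant coefficient. A positive conjugate rules out
  norm -1.\<close>

lemma quadratic_unit_relation:
  assumes "quadratic \<beta>" "algebraic_unit \<beta>"
    and "complex_of_real \<beta>' \<in> conjugates \<beta>" "\<beta>' \<noteq> \<beta>" "\<beta> > 1" "\<beta>' > 0"
  obtains m :: int where "\<beta>' = 1 / \<beta>" "\<beta> + 1 / \<beta> = of_int m"
proof -
  obtain p where p: "is_min_poly p \<beta>" "degree p = 2"
    using assms(1) by (auto simp: quadratic_def)
  then have irr: "irreducible p" and root: "poly (map_poly of_rat p) \<beta> = 0"
    by (auto simp: is_min_poly_def)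
  obtain a P0 where a: "a \<noteq> 0" and P0: "map_poly of_int P0 = smult (rat_of_int a) p"
    by (rule rat_poly_common_denominator)
  define P where "P = primitive_part P0"
  have P0_eq: "P0 = smult (content P0) P"
    by (simp add: P_def)
  have P0_nz: "P0 \<noteq> 0" using P0 a p(2) by auto
  then have c_nz: "content P0 \<noteq> 0" by simp
  have "smult (rat_of_int (content P0)) (map_poly of_int P) = smult (rat_of_int a) p"
    using P0 P0_eq by (metis map_poly_smult of_int_0 of_int_mult)
  then have P_p: "map_poly of_int P = smult (rat_of_int a / rat_of_int (content P0)) p"
    using c_nz by (metis smult_smult divide_inverse mult.commute of_int_eq_0_iff right_inverse smult_1_left)
  define k where "k = rat_of_int a / rat_of_int (content P0)"
  have k: "k \<noteq> 0" "map_poly of_int P = smult k p"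
    using a c_nz P_p by (auto simp: k_def)
  have degP: "degree P = 2"
  proof -
    have "degree P = degree (map_poly of_int P :: rat poly)"
      by (rule sym, rule degree_map_poly) simp
    then show ?thesis using k p(2) by simp
  qed
  have cont: "content P = 1"
    using P0_nz by (simp add: P_def)
  have dvdI: "P dvd f" if "poly (map_poly of_int f) \<beta> = 0" for f
  proof (rule primitive_dvd_int_poly[OF cont])
    have "p dvd map_poly of_int f"
      using that irr root irreducible_dvd_common_root[of p \<beta> "map_poly of_int f"]
      by (simp add: map_poly_of_rat_of_int)
    then show "map_poly rat_of_int P dvd map_poly rat_of_int f"
      using k by (simp add: smult_dvd)
  qed
  obtain f where f: "poly (map_poly of_int f) \<beta> = 0" "lead_coeff f = 1"
    using assms(2) by (auto simp: algebraic_unit_def algebraic_int_altdef_ipoly)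
  obtain h where h: "poly (map_poly of_int h) (inverse \<beta>) = 0" "lead_coeff h = 1"
    using assms(2) by (auto simp: algebraic_unit_def algebraic_int_altdef_ipoly)
  \<comment> \<open>Reversing the coefficients turns a monic polynomial for
    \<open>1 / \<beta>\<close> into one with constant coefficient 1 that vanishes at
    \<open>\<beta>\<close>.\<close>
  have "poly (map_poly of_int (reflect_poly h)) \<beta> = 0"
    using h(1) assms(5)
    by (simp add: reflect_poly_map_poly_of_int[symmetric] poly_reflect_poly_nz)
  then obtain g where g: "reflect_poly h = P * g" using dvdI by (meson dvdE)
  have "coeff P 0 * coeff g 0 = 1"
    using h(2) g by (metis coeff_0_reflect_poly coeff_mult_0)
  then have cP0: "\<bar>coeff P 0\<bar> = 1"
    by (metis dvd_triv_left zdvd1_eq)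
  obtain g' where g': "f = P * g'" using dvdI[OF f(1)] by (meson dvdE)
  have "lead_coeff P * lead_coeff g' = 1"
    using f(2) g' by (simp add: lead_coeff_mult)
  then have cP2: "\<bar>coeff P 2\<bar> = 1"
    using degP by (metis dvd_triv_left zdvd1_eq)
  have eval: "poly (map_poly of_int P) t = of_int (coeff P 0) + of_int (coeff P 1) * t + of_int (coeff P 2) * t\<^sup>2"
    for t :: real
  proof -
    have "degree (map_poly of_int P :: real poly) = 2"
      using degP by (simp add: degree_map_poly)
    then show ?thesis
      by (simp add: poly_altdef coeff_map_poly numeral_2_eq_2)
  qed
  have rootP: "poly (map_poly of_int P) t = 0" if "poly (map_poly of_rat p) t = 0" for t :: real
    using that k(2) by (metis map_poly_of_rat_of_int map_poly_of_rat_smult mult_zero_right poly_smult)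
  obtain p' where p': "is_min_poly p' \<beta>" "poly (map_poly of_rat p') (complex_of_real \<beta>') = 0"
    using assms(3) by (auto simp: conjugates_def)
  \<comment> \<open>The minimal polynomial \<open>p'\<close> supplied by \<open>conjugates\<close>
    need not be syntactically \<open>p\<close>; divisibility carries its root over to
    \<open>p\<close>.\<close>
  have "p' dvd p"
    using p'(1) root irreducible_dvd_common_root by (auto simp: is_min_poly_def)
  then obtain q where "p = p' * q" by (elim dvdE)
  moreover have "complex_of_real (poly (map_poly of_rat p') \<beta>') = poly (map_poly of_rat p') (complex_of_real \<beta>')"
  proof -
    have "complex_of_real (of_rat r) = of_rat r" for r
      by (cases r) (simp add: of_rat_rat)
    then show ?thesis
      by (induction p') (auto simp: map_poly_pCons)
  qed
  ultimately have root': "poly (map_poly of_rat p) \<beta>' = 0"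
    using p'(2) by (simp add: map_poly_of_rat_mult)
  \<comment> \<open>The leading coefficient of \<open>P\<close> is its own inverse, so multiplying
    by it makes \<open>P\<close> monic: \<open>m\<close> is the trace and \<open>n\<close> the
    norm.\<close>
  define m n where "m = - coeff P 1 * coeff P 2" and "n = coeff P 0 * coeff P 2"
  have n: "\<bar>n\<bar> = 1" using cP0 cP2 by (simp add: n_def abs_mult)
  have sq: "coeff P 2 = 1 \<or> coeff P 2 = -1" using cP2 by linarith
  have quad: "t\<^sup>2 = of_int m * t - of_int n" if "poly (map_poly of_rat p) t = 0" for t :: real
    using rootP[OF that] sq by (auto simp: eval m_def n_def)
  have e: "\<beta>\<^sup>2 = of_int m * \<beta> - of_int n" "\<beta>'\<^sup>2 = of_int m * \<beta>' - of_int n"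
    using quad root root' by auto
  then have "(\<beta> - \<beta>') * (\<beta> + \<beta>' - of_int m) = 0"
    by (simp add: power2_eq_square algebra_simps)
  then have sum: "\<beta> + \<beta>' = of_int m" using assms(4) by simp
  have "\<beta>\<^sup>2 = (\<beta> + \<beta>') * \<beta> - of_int n"
    unfolding sum by (rule e(1))
  then have prod: "\<beta> * \<beta>' = of_int n"
    by (simp add: power2_eq_square algebra_simps)
  have "\<beta> * \<beta>' > 0" using assms(5,6) by simp
  then have "n = 1" using n prod by (simp add: abs_if split: if_splits)
  then have "\<beta>' = 1 / \<beta>" using prod assms(5) by (simp add: field_simps)
  then show ?thesis using that sum by simp
qed

section \<open>The natural extension and its domain\<close>

definition neg_natext :: "real \<Rightarrow> real \<times> real \<Rightarrow> real \<times> real" where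
  "neg_natext \<beta> = (\<lambda>(u, v). (T_neg \<beta> u, - v / \<beta> - of_int \<lfloor>- \<beta> * u + \<beta> / (\<beta> + 1)\<rfloor>))"

text \<open>
  The left end point of \<^term>\<open>I_neg \<beta>\<close> and \<open>- 1 / (\<beta> (\<beta> + 1))\<close> are exchanged by \<^term>\<open>T_neg \<beta>\<close>, so
  the two intervals that they cut out form a Markov partition. The fibre over each of them is the
  interior of the interval that solves the corresponding set equation.
\<close>

definition neg_natext_domain :: "real \<Rightarrow> (real \<times> real) set" where
  "neg_natext_domain \<beta> = {(u, v). u \<in> I_neg \<beta>
     \<and> - (\<beta>\<^sup>2 + 1) / (\<beta> + 1) < v \<and> v < (\<beta> - 1) / (\<beta> + 1)
     \<and> (u > - 1 / (\<beta> * (\<beta> + 1)) \<longrightarrow> - \<beta> * (\<beta> - 1) / (\<beta> + 1) < v)}"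

text \<open>To the right of the partition point \<open>- 1 / (\<beta> * (\<beta> + 1))\<close> the
  only digit is 0. Elsewhere the digits run from 1 to at most \<open>m - 1\<close>, and
  \<open>m - 1\<close> occurs only if the image is not to the right of that point. These
  restrictions keep the new second coordinate in the fibre over the image.\<close>

lemma neg_natext_in_domain:
  fixes \<beta> :: real and m :: int
  assumes "\<beta> > 2" and m: "\<beta> + 1 / \<beta> = of_int m"
    and "z \<in> neg_natext_domain \<beta>"
  shows "neg_natext \<beta> z \<in> neg_natext_domain \<beta>"
proof -
  obtain u v where z: "z = (u, v)" by (cases z)
  define d where "d = \<lfloor>- \<beta> * u + \<beta> / (\<beta> + 1)\<rfloor>"
  define w where "w = - v / \<beta> - of_int d"
  \<comment> \<open>With \<open>\<beta> * e = 1 - e\<close>, \<open>\<beta> * g = 1\<close> and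
    \<open>g * e = g - e\<close>, all end points become linear in \<open>\<beta>\<close>,
    \<open>e\<close> and \<open>g\<close>, which leaves linear arithmetic.\<close>
  define e where "e = 1 / (\<beta> + 1)"
  define g where "g = 1 / \<beta>"
  have e: "\<beta> * e = 1 - e" and g: "\<beta> * g = 1" and gm: "of_int m = \<beta> + g"
    using assms by (auto simp: e_def g_def field_simps)
  have e0: "e > 0" and g0: "0 < g" "g < 1" using assms by (auto simp: e_def g_def)
  have ge: "g * e = g - e"
    using assms(1) by (simp add: e_def g_def field_simps)
  have be: "\<beta> / (\<beta> + 1) = 1 - e" "- (\<beta>\<^sup>2 + 1) / (\<beta> + 1) = 1 - \<beta> - 2 * e" "(\<beta> - 1) / (\<beta> + 1) = 1 - 2 * e"
    "- 1 / (\<beta> * (\<beta> + 1)) = e - g" "- \<beta> * (\<beta> - 1) / (\<beta> + 1) = 2 - \<beta> - 2 * e" "1 / (\<beta> + 1) = e"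
    using assms(1) by (simp_all add: e_def g_def field_simps power2_eq_square)
  have e3: "e < 1 / 3" using assms(1) by (simp add: e_def)
  have dom: "(u, v) \<in> neg_natext_domain \<beta> \<longleftrightarrow> e - 1 \<le> u \<and> u < e \<and> 1 - \<beta> - 2 * e < v \<and> v < 1 - 2 * e
      \<and> (u > e - g \<longrightarrow> 2 - \<beta> - 2 * e < v)" for u v
    unfolding neg_natext_domain_def mem_Collect_eq case_prod_conv I_neg_def be atLeastLessThan_iff by auto
  note uv = assms(3)[unfolded z dom]
  have Tu: "T_neg \<beta> u = - \<beta> * u - of_int d" by (simp add: T_neg_def d_def)
  have TI: "e - 1 \<le> T_neg \<beta> u" "T_neg \<beta> u < e"
    using T_neg_in_I_neg[of \<beta> u] assms(1) by (auto simp: I_neg_def be)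
  have w: "w = - (g * v) - of_int d" by (simp add: w_def g_def)
  have gv1: "g * v < g * (1 - 2 * e)" and gv2: "g * (1 - \<beta> - 2 * e) < g * v"
    using uv g0 by simp_all
  have gv1': "g * v < 2 * e - g" using gv1 ge by (simp add: algebra_simps)
  have gv2': "2 * e - g - 1 < g * v" using gv2 ge g by (simp add: algebra_simps)
  have goal: "1 - \<beta> - 2 * e < w \<and> w < 1 - 2 * e \<and> (T_neg \<beta> u > e - g \<longrightarrow> 2 - \<beta> - 2 * e < w)"
  proof (cases "u > e - g")
    case True
    have "\<beta> * (e - g) < \<beta> * u" "\<beta> * u < \<beta> * e"
      using True uv assms(1) by simp_all
    then have "- e < \<beta> * u" "\<beta> * u < 1 - e" using e g by (simp_all add: algebra_simps)
    then have d: "d = 0" unfolding d_def be by (intro floor_unique) auto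
    have "g * (2 - \<beta> - 2 * e) < g * v" using True uv g0 by simp
    then have "2 * e - 1 < g * v" using ge g by (simp add: algebra_simps)
    then show ?thesis using gv1' d w g0 e0 assms(1) e3 by auto
  next
    case False
    have "\<beta> * u \<le> \<beta> * (e - g)" "\<beta> * (e - 1) \<le> \<beta> * u"
      using False uv assms(1) by simp_all
    then have u: "\<beta> * u \<le> - e" "1 - e - \<beta> \<le> \<beta> * u" using e g by (simp_all add: algebra_simps)
    have d1: "1 \<le> d" unfolding d_def be le_floor_iff using u by simp
    have "d < m" unfolding d_def be floor_less_iff using u gm g0 by simp
    then have d2: "d \<le> m - 1" by simp
    have "w < 1 - 2 * e" using gv2' d1 w e3 g0 
      by (smt (verit) of_int_1_le_iff)
    moreover have "1 - \<beta> - 2 * e < w"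
    proof -
      have "real_of_int d \<le> \<beta> + g - 1" using d2 gm by linarith
      then show ?thesis using gv1' w by linarith
    qed
    moreover have "2 - \<beta> - 2 * e < w" if "T_neg \<beta> u > e - g"
    proof -
      \<comment> \<open>Here \<open>d = - \<beta> * u - T_neg \<beta> u\<close>, where the first
        term is at most \<open>\<beta> + e - 1\<close> and the second is less than
        \<open>g - e\<close>.\<close>
      have "real_of_int d < real_of_int (m - 1)" using that Tu u(2) gm by simp
      then have "d \<le> m - 2" by linarith
      then have "real_of_int d \<le> \<beta> + g - 2" using gm by linarith
      then show ?thesis using gv1' w by linarith
    qed
    ultimately show ?thesis by blast
  qed
  have "neg_natext \<beta> z = (T_neg \<beta> u, w)"
    by (simp add: neg_natext_def z w_def d_def)
  then show ?thesis using goal TI dom by simp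
qed

text \<open>The fibres of the domain are open and of length at most \<^term>\<open>\<beta>\<close>, while two preimages with
  different digits have second coordinates at distance at least \<^term>\<open>\<beta>\<close>.\<close>

lemma inj_on_neg_natext:
  assumes "\<beta> > 1"
  shows "inj_on (neg_natext \<beta>) (neg_natext_domain \<beta>)"
proof (rule inj_onI)
  fix z z' assume z: "z \<in> neg_natext_domain \<beta>" and z': "z' \<in> neg_natext_domain \<beta>"
    and eq: "neg_natext \<beta> z = neg_natext \<beta> z'"
  obtain u v u' v' where uv: "z = (u, v)" "z' = (u', v')" by (cases z, cases z')
  define d d' where "d = \<lfloor>- \<beta> * u + \<beta> / (\<beta> + 1)\<rfloor>" and "d' = \<lfloor>- \<beta> * u' + \<beta> / (\<beta> + 1)\<rfloor>"
  have "- \<beta> * u - of_int d = - \<beta> * u' - of_int d'" and v: "- v / \<beta> - of_int d = - v' / \<beta> - of_int d'"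
    using eq by (auto simp: neg_natext_def uv T_neg_def d_def d'_def)
  have "(\<beta> - 1) / (\<beta> + 1) - (- (\<beta>\<^sup>2 + 1) / (\<beta> + 1)) = \<beta>"
    using assms by (simp add: diff_divide_distrib[symmetric] divide_eq_eq power2_eq_square algebra_simps)
  then have "\<bar>v' - v\<bar> < \<beta>"
    using z z' unfolding neg_natext_domain_def uv mem_Collect_eq case_prod_conv by linarith
  moreover have vv: "v' - v = \<beta> * of_int (d - d')"
    using v assms by (simp add: field_simps)
  ultimately have "\<beta> * \<bar>real_of_int (d - d')\<bar> < \<beta> * 1"
    using assms by (simp add: abs_mult)
  then have "\<bar>real_of_int (d - d')\<bar> < 1" using assms by (simp only: mult_less_cancel_left_pos)
  then have "d = d'" by linarith
  then show "z = z'" using \<open>- \<beta> * u - of_int d = _\<close> vv uv assms by simp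
qed

section \<open>The lattice of conjugate pairs\<close>

definition conj_lattice :: "real \<Rightarrow> nat \<Rightarrow> (real \<times> real) set" where
  "conj_lattice \<beta> N = {((of_int p + of_int q * \<beta>) / of_nat N, (of_int p + of_int q / \<beta>) / of_nat N) |p q. True}"

lemma neg_natext_in_conj_lattice:
  assumes "\<beta> > 1" "N > 0" "\<beta> + 1 / \<beta> = of_int m" "z \<in> conj_lattice \<beta> N"
  shows "neg_natext \<beta> z \<in> conj_lattice \<beta> N"
proof -
  obtain p q where z: "z = ((of_int p + of_int q * \<beta>) / of_nat N, (of_int p + of_int q / \<beta>) / of_nat N)"
    using assms(4) by (auto simp: conj_lattice_def)
  define d where "d = \<lfloor>- \<beta> * fst z + \<beta> / (\<beta> + 1)\<rfloor>"
  \<comment> \<open>Multiply by \<open>- \<beta>\<close> and reduce with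
    \<open>\<beta>^2 = m * \<beta> - 1\<close>. Since \<open>1 / \<beta>\<close> satisfies the same
    equation, the same coefficients serve the second coordinate.\<close>
  define p' q' where "p' = q - d * int N" and "q' = - p - q * m"
  have 1: "neg_natext \<beta> z = (- \<beta> * fst z - of_int d, - snd z / \<beta> - of_int d)"
    by (simp add: neg_natext_def T_neg_def d_def split_beta)
  have 2: "- \<beta> * fst z - of_int d = (of_int p' + of_int q' * \<beta>) / of_nat N"
    using assms(1,2) by (simp add: z p'_def q'_def assms(3)[symmetric] field_simps)
  have 3: "- snd z / \<beta> - of_int d = (of_int p' + of_int q' / \<beta>) / of_nat N"
    using assms(1,2) by (simp add: z p'_def q'_def assms(3)[symmetric] field_simps)
  show ?thesis unfolding 1 2 3 conj_lattice_def by blast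
qed

text \<open>The difference \<open>u - v\<close> is \<open>q * (\<beta> - 1 / \<beta>) / N\<close>,
  so bounding both coordinates bounds \<open>q\<close> by \<open>Q\<close>, and then
  \<open>p\<close> by \<open>P\<close>.\<close>

lemma finite_conj_lattice_bounded:
  assumes "\<beta> > 1" "N > 0"
  shows "finite {(u, v) \<in> conj_lattice \<beta> N. \<bar>u\<bar> \<le> B \<and> \<bar>v\<bar> \<le> B}"
proof -
  define Q where "Q = of_nat N * (2 * B) / (\<beta> - 1 / \<beta>)"
  define P where "P = of_nat N * B + Q * \<beta>"
  define pr where "pr = (\<lambda>(p, q). ((of_int p + of_int q * \<beta>) / of_nat N, (of_int p + of_int q / \<beta>) / of_nat N))"
  have pos: "\<beta> - 1 / \<beta> > 0" using assms(1) by (simp add: field_simps less_1_mult)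
  have "{(u, v) \<in> conj_lattice \<beta> N. \<bar>u\<bar> \<le> B \<and> \<bar>v\<bar> \<le> B} \<subseteq> pr ` ({- \<lceil>P\<rceil>..\<lceil>P\<rceil>} \<times> {- \<lceil>Q\<rceil>..\<lceil>Q\<rceil>})"
  proof clarify
    fix u v assume "(u, v) \<in> conj_lattice \<beta> N" and B: "\<bar>u\<bar> \<le> B" "\<bar>v\<bar> \<le> B"
    then obtain p q where uv: "u = (of_int p + of_int q * \<beta>) / of_nat N" "v = (of_int p + of_int q / \<beta>) / of_nat N"
      by (auto simp: conj_lattice_def)
    have "real_of_int q * (\<beta> - 1 / \<beta>) = of_nat N * (u - v)"
      using assms by (simp add: uv field_simps)
    then have "\<bar>real_of_int q\<bar> * (\<beta> - 1 / \<beta>) = of_nat N * \<bar>u - v\<bar>"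
      using pos by (metis abs_mult abs_of_nat abs_of_pos)
    also have "\<dots> \<le> of_nat N * (2 * B)" using B by (intro mult_left_mono) auto
    finally have q: "\<bar>real_of_int q\<bar> \<le> Q" using pos by (simp add: Q_def pos_le_divide_eq)
    have "real_of_int p = of_nat N * u - of_int q * \<beta>"
      using assms by (simp add: uv)
    then have "\<bar>real_of_int p\<bar> \<le> of_nat N * \<bar>u\<bar> + \<bar>of_int q\<bar> * \<beta>"
      using assms(1) abs_triangle_ineq4[of "of_nat N * u" "of_int q * \<beta>"] by (simp add: abs_mult)
    also have "\<dots> \<le> P"
      unfolding P_def using q B assms(1) by (intro add_mono mult_left_mono mult_right_mono) auto
    finally have p: "\<bar>real_of_int p\<bar> \<le> P" .
    have "\<bar>p\<bar> \<le> \<lceil>P\<rceil>" "\<bar>q\<bar> \<le> \<lceil>Q\<rceil>"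
      using p q by (metis ceiling_mono ceiling_of_int of_int_abs)+
    then have "(p, q) \<in> {- \<lceil>P\<rceil>..\<lceil>P\<rceil>} \<times> {- \<lceil>Q\<rceil>..\<lceil>Q\<rceil>}" by auto
    moreover have "(u, v) = pr (p, q)" by (simp add: pr_def uv)
    ultimately show "(u, v) \<in> pr ` ({- \<lceil>P\<rceil>..\<lceil>P\<rceil>} \<times> {- \<lceil>Q\<rceil>..\<lceil>Q\<rceil>})" by blast
  qed
  then show ?thesis by (rule finite_subset) simp
qed

section \<open>Periodic orbits and periodic streams\<close>

text \<open>By finiteness the orbit repeats a value; injectivity strips the common initial iterates,
  so the orbit has no preperiod.\<close>

lemma inj_on_finite_funpow_periodic:
  assumes "finite S" "f ` S \<subseteq> S" "inj_on f S" "x \<in> S"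
  obtains n where "n > 0" "(f ^^ n) x = x"
proof -
  have orbit: "(f ^^ i) x \<in> S" for i
    using assms(2,4) by (induction i) auto
  have "\<not> inj (\<lambda>i. (f ^^ i) x)"
    using orbit assms(1) by (meson finite_imageD finite_subset image_subsetI infinite_UNIV_nat)
  then obtain i j where ij: "i < j" "(f ^^ i) x = (f ^^ j) x"
    by (auto simp: inj_def) (metis linorder_neqE_nat)
  have "(f ^^ i) x = (f ^^ (i + n)) x \<Longrightarrow> (f ^^ n) x = x" for i n
  proof (induction i)
    case (Suc i)
    then have "f ((f ^^ i) x) = f ((f ^^ (i + n)) x)" by simp
    then have "(f ^^ i) x = (f ^^ (i + n)) x" by (rule inj_onD[OF assms(3)]) (rule orbit)+
    then show ?case by (rule Suc.IH)
  qed simp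
  from this[of i "j - i"] ij have "(f ^^ (j - i)) x = x" by simp
  then show ?thesis using that[of "j - i"] ij(1) by simp
qed

text \<open>The bisimulation is closed under tails because passing to \<open>stl s\<close> rotates
  the word: its first letter moves to the end.\<close>

lemma eq_cycle_if_eq_shift:
  assumes "w \<noteq> []" "s = w @- s"
  shows "s = cycle w"
  using assms
proof (coinduction arbitrary: s w rule: stream.coinduct)
  case Eq_stream
  then obtain a w' where w: "w = a # w'" by (cases w) auto
  then have hd: "shd s = a" and tl: "stl s = w' @- s"
    using Eq_stream(2) by (metis shift.simps(2) stream.sel)+
  have "s = a ## stl s" using hd by (metis stream.collapse)
  then have "stl s = (w' @ [a]) @- stl s"
    using tl by (metis shift.simps shift_append)
  then show ?case using hd w by (intro conjI exI[of _ "stl s"] exI[of _ "w' @ [a]"]) auto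
qed

lemma purely_periodic_if_sdrop_eq:
  assumes "n > 0" "sdrop n s = s"
  shows "purely_periodic s"
proof -
  have "stake n s \<noteq> []" using assms(1) by (metis length_stake list.size(3) less_irrefl)
  moreover have "s = stake n s @- s" using assms(2) stake_sdrop[of n s] by simp
  ultimately show ?thesis
    unfolding purely_periodic_def by (metis eq_cycle_if_eq_shift)
qed

lemma purely_periodic_d_neg_if_periodic_point:
  assumes "n > 0" "(T_neg \<beta> ^^ n) x = x"
  shows "purely_periodic (d_neg \<beta> x)"
proof (rule purely_periodic_if_sdrop_eq[OF assms(1)])
  \<comment> \<open>Streams are indexed from 0 but digits from 1: entry \<open>i\<close> of the
    stream is digit \<open>Suc i\<close>, which is read off the \<open>i\<close>-th iterate.\<close>
  have "digit_neg \<beta> x (Suc (n + i)) = digit_neg \<beta> x (Suc i)" for i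
    using assms(2) by (simp add: digit_neg_def funpow_add add.commute[of n])
  then have "d_neg \<beta> x = sdrop n (d_neg \<beta> x)"
    unfolding d_neg_def by (subst smap_alt) (simp add: sdrop_snth add.commute[of _ n])
  then show "sdrop n (d_neg \<beta> x) = d_neg \<beta> x" by simp
qed

section \<open>Pure periodicity for rational points\<close>

theorem theorem4:
  fixes \<beta> \<beta>' x :: real
  assumes "\<beta> > 1"
    and "quadratic \<beta>"
    and "pisot \<beta>"
    and "algebraic_unit \<beta>"
    and "complex_of_real \<beta>' \<in> conjugates \<beta>" and "\<beta>' \<noteq> \<beta>" and "\<beta>' > 0"
    and "x \<in> \<rat>" and "x \<in> I_neg \<beta>"
  shows "purely_periodic (d_neg \<beta> x)"
proof -
  obtain m where m: "\<beta> + 1 / \<beta> = of_int m"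
    using quadratic_unit_relation[OF assms(2,4,5,6,1,7)] by blast
  \<comment> \<open>The integer \<open>\<beta> + 1 / \<beta>\<close> exceeds 2, so it is at least 3.
    This yields the bound \<open>\<beta> > 2\<close> under which the domain was shown to be
    invariant.\<close>
  have "(\<beta> - 1)\<^sup>2 > 0" using assms(1) by simp
  then have "\<beta> + 1 / \<beta> > 2"
    using assms(1) by (simp add: field_simps power2_eq_square)
  then have "m \<ge> 3" using m by linarith
  then have "\<beta> + 1 / \<beta> \<ge> 3" using m by linarith
  moreover have "1 / \<beta> < 1" using assms(1) by simp
  ultimately have b2: "\<beta> > 2" by linarith
  obtain p r :: int where r: "r > 0" and xr: "x = of_int p / of_int r"
    using assms(8) by (rule Rats_cases')
  define N where "N = nat r"
  have N: "N > 0" and x: "x = of_int p / of_nat N"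
    using r xr by (simp_all add: N_def)
  \<comment> \<open>Summing the absolute values of the outer end points gives one bound for both
    coordinates.\<close>
  define B where "B = \<bar>- (\<beta>\<^sup>2 + 1) / (\<beta> + 1)\<bar> + \<bar>(\<beta> - 1) / (\<beta> + 1)\<bar> + \<bar>\<beta> / (\<beta> + 1)\<bar> + \<bar>1 / (\<beta> + 1)\<bar>"
  define S where "S = neg_natext_domain \<beta> \<inter> conj_lattice \<beta> N"
  have "S \<subseteq> {(u, v) \<in> conj_lattice \<beta> N. \<bar>u\<bar> \<le> B \<and> \<bar>v\<bar> \<le> B}"
  proof clarify
    fix u v assume uv: "(u, v) \<in> S"
    then have "- (\<beta> / (\<beta> + 1)) \<le> u" "u < 1 / (\<beta> + 1)"
      "- (\<beta>\<^sup>2 + 1) / (\<beta> + 1) < v" "v < (\<beta> - 1) / (\<beta> + 1)"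
      unfolding S_def neg_natext_domain_def I_neg_def by auto
    then have "\<bar>u\<bar> \<le> B" "\<bar>v\<bar> \<le> B" unfolding B_def by linarith+
    then show "(u, v) \<in> conj_lattice \<beta> N \<and> \<bar>u\<bar> \<le> B \<and> \<bar>v\<bar> \<le> B"
      using uv by (simp add: S_def)
  qed
  then have fin: "finite S"
    using finite_conj_lattice_bounded[OF assms(1) N] finite_subset by blast
  have inv: "neg_natext \<beta> ` S \<subseteq> S"
    using neg_natext_in_domain[OF b2 m] neg_natext_in_conj_lattice[OF assms(1) N m] by (auto simp: S_def)
  have inj: "inj_on (neg_natext \<beta>) S"
    using inj_on_neg_natext[OF assms(1)] by (rule inj_on_subset) (simp add: S_def)
  have "(x, x) = ((of_int p + of_int 0 * \<beta>) / of_nat N, (of_int p + of_int 0 / \<beta>) / of_nat N)"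
    by (simp add: x)
  then have "(x, x) \<in> conj_lattice \<beta> N" unfolding conj_lattice_def by blast
  moreover have "(x, x) \<in> neg_natext_domain \<beta>"
  proof -
    \<comment> \<open>On the diagonal, the outer bounds on \<open>v\<close> hold throughout
      \<open>I_neg \<beta>\<close>. The conditional lower bound follows from its own premise, since
      it does not exceed the partition point.\<close>
    have "\<beta> < \<beta>\<^sup>2 + 1"
      using b2 self_le_power[of \<beta> 2] by linarith
    then have "\<beta> / (\<beta> + 1) < (\<beta>\<^sup>2 + 1) / (\<beta> + 1)"
      using b2 by (intro divide_strict_right_mono) auto
    then have "- (\<beta>\<^sup>2 + 1) / (\<beta> + 1) < - (\<beta> / (\<beta> + 1))"
      by (simp only: minus_divide_left[symmetric] neg_less_iff_less)
    moreover have "1 / (\<beta> + 1) \<le> (\<beta> - 1) / (\<beta> + 1)"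
      using b2 by (simp add: divide_right_mono)
    moreover have "- \<beta> * (\<beta> - 1) / (\<beta> + 1) \<le> - 1 / (\<beta> * (\<beta> + 1))"
    proof -
      have "1 / \<beta> \<le> \<beta> * (\<beta> - 1)"
        using b2 mult_mono[of 1 \<beta> 1 "\<beta> - 1"] \<open>1 / \<beta> < 1\<close> by linarith
      then have "1 / \<beta> / (\<beta> + 1) \<le> \<beta> * (\<beta> - 1) / (\<beta> + 1)"
        using b2 by (intro divide_right_mono) auto
      then show ?thesis by simp
    qed
    ultimately show ?thesis
      using assms(9) unfolding neg_natext_domain_def I_neg_def by auto
  qed
  ultimately have "(x, x) \<in> S" by (simp add: S_def)
  then obtain n where n: "n > 0" "(neg_natext \<beta> ^^ n) (x, x) = (x, x)"
    using inj_on_finite_funpow_periodic[OF fin inv inj] by metis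
  \<comment> \<open>The first coordinate evolves independently of the second, so a period of the
    pair is a period of \<open>x\<close>.\<close>
  have fst_funpow: "fst ((neg_natext \<beta> ^^ k) z) = (T_neg \<beta> ^^ k) (fst z)" for k z
    by (induction k) (auto simp: neg_natext_def split_beta)
  have "(T_neg \<beta> ^^ n) x = x" using fst_funpow[of n "(x, x)"] n(2) by simp
  with n(1) show ?thesis by (rule purely_periodic_d_neg_if_periodic_point)
qed

end
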